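(* For an integer $d\ge 0$ let $g(d)$ be the number of squares that a knight on an infinite chessboard can reach from a fixed starting square in $d$ moves and in no fewer than $d$ moves. Then $$g(d)=\begin{cases}1 & d=0,\\ 8 & d=1,\\ 32 & d=2,\\ 68 & d=3,\\ 96 & d=4,\\ 28d-20 & d\ge 5.\end{cases}$$
   Context: The infinite chessboard has squares identified with $\mathbb{Z}^2$. A knight move adds to the current position one of the eight vectors $(\pm1,\pm2)$, $(\pm2,\pm1)$ (all sign choices). A square is reached in $d$ moves if it is the final position of some sequence of exactly $d$ knight moves from the starting square; thus $g(d)$ counts the squares reachable in exactly $d$ moves that are not reachable in exactly $i$ moves for any $0\le i<d$. *)

theory Defs
  imports Main
begin

definition knight_vectors :: "(int \<times> int) set" where
  "knight_vectors = {1, -1} \<times> {2, -2} \<union> {2, -2} \<times> {1, -1}"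

definition knight_move :: "((int \<times> int) \<times> (int \<times> int)) set" where
  "knight_move = {((x, y), (x + a, y + b)) | x y a b. (a, b) \<in> knight_vectors}"

definition reached_in :: "int \<times> int \<Rightarrow> nat \<Rightarrow> (int \<times> int) set" where
  "reached_in s d = {t. (s, t) \<in> knight_move ^^ d}"

definition new_squares :: "int \<times> int \<Rightarrow> nat \<Rightarrow> (int \<times> int) set" where
  "new_squares s d = {t \<in> reached_in s d. \<forall>i<d. t \<notin> reached_in s i}"

definition g :: "int \<times> int \<Rightarrow> nat \<Rightarrow> nat" where
  "g s d = card (new_squares s d)"

end

theory Submission
  imports Defs
begin

text \<open>
  After \<open>d\<close> moves the displacement \<open>(x, y)\<close> of the knight satisfies
  \<open>\<bar>x\<bar> \<le> 2d\<close>, \<open>\<bar>y\<bar> \<le> 2d\<close> and \<open>\<bar>x\<bar> + \<bar>y\<bar> \<le> 3d\<close>, and \<open>x + y\<close> has the parity of \<open>d\<close>, because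
  one move changes these quantities by at most 2, 2 and 3 and flips the parity. Call the lattice points satisfying these conditions
  the octagon of \<open>d\<close>. The key fact (\<open>reached_in_iff\<close>) is that these necessary conditions are also
  sufficient, with eight exceptions: for \<open>d = 1\<close> the four
  orthogonal neighbours of the start, and for \<open>d = 2\<close> the four squares \<open>(\<plusminus>2, \<plusminus>2)\<close>.
  Sufficiency is an induction on \<open>d\<close>: by symmetry \<open>0 \<le> y \<le> x\<close>, and then taking back the
  move \<open>(2, 1)\<close> leads into the octagon of \<open>d - 1\<close>; only for \<open>d \<le> 3\<close> can this hit an exceptional
  square, and then another move works.

  The octagon has \<open>7d\<^sup>2 + 4d + 1\<close> points (\<open>card_octagon\<close>). The squares reached in exactly \<open>d\<close>
  moves grow with \<open>d\<close> along each parity class, so that the squares reached for the first time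
  at move \<open>d \<ge> 2\<close> are those reached in \<open>d\<close> but not in \<open>d - 2\<close> moves. For \<open>d \<ge> 5\<close> no exceptions
  interfere, and their number is
  \<open>7d\<^sup>2 + 4d - 7(d - 2)\<^sup>2 - 4(d - 2) = 28d - 20\<close>;
  for \<open>2 \<le> d \<le> 4\<close> the four missing points at \<open>d = 1\<close> and at \<open>d = 2\<close> account for the irregular values.
\<close>

section \<open>The squares reached in exactly \<open>d\<close> moves\<close>

definition octagon :: "nat \<Rightarrow> (int \<times> int) set" where
  "octagon d = {(x, y). \<bar>x\<bar> \<le> 2 * int d \<and> \<bar>y\<bar> \<le> 2 * int d \<and> \<bar>x\<bar> + \<bar>y\<bar> \<le> 3 * int d
     \<and> even (x + y + int d)}"

definition unreached :: "nat \<Rightarrow> (int \<times> int) set" where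
  "unreached d = (if d = 1 then {(1, 0), (-1, 0), (0, 1), (0, -1)}
     else if d = 2 then {2, -2} \<times> {2, -2} else {})"

definition knight_range :: "nat \<Rightarrow> (int \<times> int) set" where
  "knight_range d = octagon d - unreached d"

lemma knight_range_iff:
  "(x, y) \<in> knight_range d \<longleftrightarrow>
     \<bar>x\<bar> \<le> 2 * int d \<and> \<bar>y\<bar> \<le> 2 * int d \<and> \<bar>x\<bar> + \<bar>y\<bar> \<le> 3 * int d \<and> even (x + y + int d)
     \<and> \<not> (d = 1 \<and> \<bar>x\<bar> + \<bar>y\<bar> = 1) \<and> \<not> (d = 2 \<and> \<bar>x\<bar> = 2 \<and> \<bar>y\<bar> = 2)"
  unfolding knight_range_def octagon_def unreached_def by (auto split: if_splits)

lemma knight_range_reflect: "(- x, y) \<in> knight_range d \<longleftrightarrow> (x, y) \<in> knight_range d"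
  by (auto simp: knight_range_iff)

lemma knight_range_swap: "(y, x) \<in> knight_range d \<longleftrightarrow> (x, y) \<in> knight_range d"
  by (auto simp: knight_range_iff add.commute)

lemma knight_vectors_reflect: "(- a, b) \<in> knight_vectors \<longleftrightarrow> (a, b) \<in> knight_vectors"
  unfolding knight_vectors_def by auto

lemma knight_vectors_swap: "(b, a) \<in> knight_vectors \<longleftrightarrow> (a, b) \<in> knight_vectors"
  unfolding knight_vectors_def by auto

lemma knight_range_step:
  assumes "(x, y) \<in> knight_range d" "(a, b) \<in> knight_vectors"
  shows "(x + a, y + b) \<in> knight_range (Suc d)"
proof -
  have ab: "(\<bar>a\<bar> = 1 \<and> \<bar>b\<bar> = 2) \<or> (\<bar>a\<bar> = 2 \<and> \<bar>b\<bar> = 1)" and odd: "odd (a + b)"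
    using assms(2) by (auto simp: knight_vectors_def)
  have xy: "\<bar>x\<bar> \<le> 2 * int d" "\<bar>y\<bar> \<le> 2 * int d" "\<bar>x\<bar> + \<bar>y\<bar> \<le> 3 * int d" "even (x + y + int d)"
    using assms(1) by (auto simp: knight_range_iff)
  have "\<bar>x + a\<bar> \<le> 2 * int (Suc d)" "\<bar>y + b\<bar> \<le> 2 * int (Suc d)"
    "\<bar>x + a\<bar> + \<bar>y + b\<bar> \<le> 3 * int (Suc d)"
    using xy(1-3) ab by (simp_all, linarith+)
  moreover have "even ((x + a) + (y + b) + int (Suc d))" using xy(4) odd by simp blast
  moreover have "\<not> (Suc d = 1 \<and> \<bar>x + a\<bar> + \<bar>y + b\<bar> = 1)" using xy ab by auto
  \<comment> \<open>If \<open>x\<close> and \<open>a\<close> are \<open>\<plusminus>1\<close> or \<open>\<plusminus>2\<close> with \<open>x + a = \<plusminus>2\<close>, then both are odd, so that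
    \<open>y\<close> and \<open>b\<close> are \<open>\<plusminus>2\<close> and \<open>y + b\<close> is 0 or \<open>\<plusminus>4\<close>.\<close>
  moreover have "\<not> (Suc d = 2 \<and> \<bar>x + a\<bar> = 2 \<and> \<bar>y + b\<bar> = 2)"
  proof
    assume *: "Suc d = 2 \<and> \<bar>x + a\<bar> = 2 \<and> \<bar>y + b\<bar> = 2"
    then have d: "d = 1" by simp
    have xy1: "\<bar>x\<bar> \<le> 2" "\<bar>y\<bar> \<le> 2" "\<bar>x\<bar> + \<bar>y\<bar> \<le> 3" "odd (x + y)" "\<bar>x\<bar> + \<bar>y\<bar> \<noteq> 1"
      using assms(1) by (auto simp: knight_range_iff d)
    then have "\<bar>x\<bar> + \<bar>y\<bar> = 3" by presburger
    with xy1 have "(\<bar>x\<bar> = 1 \<and> \<bar>y\<bar> = 2) \<or> (\<bar>x\<bar> = 2 \<and> \<bar>y\<bar> = 1)" by linarith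
    with ab * show False by linarith
  qed
  ultimately show ?thesis unfolding knight_range_iff by blast
qed

definition retractable :: "nat \<Rightarrow> int \<Rightarrow> int \<Rightarrow> bool" where
  "retractable d x y \<longleftrightarrow> (\<exists>(a, b) \<in> knight_vectors. (x - a, y - b) \<in> knight_range d)"

lemma retractableI:
  "(a, b) \<in> knight_vectors \<Longrightarrow> (x - a, y - b) \<in> knight_range d \<Longrightarrow> retractable d x y"
  unfolding retractable_def by blast

lemma retractable_reflect: "retractable d (- x) y \<Longrightarrow> retractable d x y"
proof -
  assume "retractable d (- x) y"
  then obtain a b where "(a, b) \<in> knight_vectors" "(- (x + a), y - b) \<in> knight_range d"
    unfolding retractable_def by auto
  then show ?thesis
    using retractableI[of "- a" b x y d] knight_range_reflect[of "x + a" "y - b" d]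
      knight_vectors_reflect by simp
qed

lemma retractable_swap: "retractable d y x \<Longrightarrow> retractable d x y"
proof -
  assume "retractable d y x"
  then obtain a b where "(a, b) \<in> knight_vectors" "(y - a, x - b) \<in> knight_range d"
    unfolding retractable_def by auto
  then show ?thesis
    using retractableI[of b a x y d] knight_range_swap knight_vectors_swap by blast
qed

text \<open>
  Away from the axes, taking back \<open>(2, 1)\<close> lowers \<open>x\<close> by 2 and \<open>x + y\<close> by 3, which are the rates
  at which the bounds of the octagon shrink; near the axes the bounds leave enough room.
  The four points treated separately are those for which this leads to an orthogonal
  neighbour of the start or to \<open>(2, 2)\<close>.
\<close>

lemma retractable_octant:
  assumes "(x, y) \<in> knight_range (Suc d)" "0 \<le> y" "y \<le> x"
  shows "retractable d x y"
proof -
  consider "d = 1" "x = 3" "y = 1" | "d = 1" "x = 2" "y = 0" | "d = 1" "x = 1" "y = 1"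
    | "d = 2" "x = 4" "y = 3" | "(x - 2, y - 1) \<in> knight_range d"
  proof -
    note cases = that
    have bounds: "x \<le> 2 * int d + 2" "x + y \<le> 3 * int d + 3" "odd (x + y + int d)"
      "\<not> (d = 0 \<and> x + y = 1)" "\<not> (d = 1 \<and> x = 2 \<and> y = 2)"
      using assms by (auto simp: knight_range_iff)
    have even: "even (x - 2 + (y - 1) + int d)" using bounds(3) by simp
    show ?thesis
    proof (cases "d = 0")
      case True
      then have "x + y \<le> 3" "x \<le> 2" "odd (x + y)" "x + y \<noteq> 1" using bounds by auto
      then have "x + y = 3" using assms(2,3) by presburger
      then have "x = 2" "y = 1" using \<open>x \<le> 2\<close> assms(3) by linarith+
      then show ?thesis using cases(5) True by (simp add: knight_range_iff)
    next
      case False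
      then have "\<bar>x - 2\<bar> \<le> 2 * int d" "\<bar>y - 1\<bar> \<le> 2 * int d"
        "\<bar>x - 2\<bar> + \<bar>y - 1\<bar> \<le> 3 * int d"
        using bounds(1,2) assms(2,3) by linarith+
      moreover have ?thesis if d: "d = 1" "\<bar>x - 2\<bar> + \<bar>y - 1\<bar> = 1"
      proof -
        have "x = 3 \<and> y = 1 \<or> x = 2 \<and> y = 0 \<or> x = 1 \<and> y = 1 \<or> x = 2 \<and> y = 2"
          using d(2) by linarith
        then show ?thesis using cases d(1) bounds(5) by blast
      qed
      moreover have ?thesis if d: "d = 2" "\<bar>x - 2\<bar> = 2" "\<bar>y - 1\<bar> = 2"
      proof -
        have "x = 4" "y = 3" using d(2,3) assms(2,3) by linarith+
        then show ?thesis using cases d(1) by blast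
      qed
      ultimately show ?thesis using even cases(5) unfolding knight_range_iff by blast
    qed
  qed
  then show ?thesis
  proof cases
    case 1
    then show ?thesis
      by (intro retractableI[of 1 2]) (auto simp: knight_vectors_def knight_range_iff)
  next
    case 2
    then show ?thesis
      by (intro retractableI[of 1 2]) (auto simp: knight_vectors_def knight_range_iff)
  next
    case 3
    then show ?thesis
      by (intro retractableI[of 2 "-1"]) (auto simp: knight_vectors_def knight_range_iff)
  next
    case 4
    then show ?thesis
      by (intro retractableI[of 1 2]) (auto simp: knight_vectors_def knight_range_iff)
  next
    case 5
    then show ?thesis
      by (intro retractableI[of 2 1]) (auto simp: knight_vectors_def)
  qed
qed

lemma retractable_knight_range:
  assumes "(x, y) \<in> knight_range (Suc d)"
  shows "retractable d x y"
proof -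
  have quadrant: "retractable d x y"
    if "(x, y) \<in> knight_range (Suc d)" "0 \<le> x" "0 \<le> y" for x y
    using that retractable_octant retractable_swap knight_range_swap linear by metis
  have half: "retractable d x y" if "(x, y) \<in> knight_range (Suc d)" "0 \<le> y" for x y
    using that quadrant[of x y] quadrant[of "- x" y] retractable_reflect knight_range_reflect
    by (cases "0 \<le> x") auto
  show ?thesis
  proof (cases "0 \<le> y")
    case True
    then show ?thesis using half assms by blast
  next
    case False
    then have "retractable d (- y) x"
      using assms half[of x "- y"] knight_range_reflect knight_range_swap retractable_swap
      by (metis neg_0_le_iff_le linear)
    then show ?thesis using retractable_reflect retractable_swap by blast
  qed
qed

lemma knight_range_Suc:
  "(x, y) \<in> knight_range (Suc d) \<longleftrightarrow> retractable d x y"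
  using retractable_knight_range knight_range_step unfolding retractable_def
  by fastforce

lemma knight_move_iff:
  "((u, v), (u', v')) \<in> knight_move \<longleftrightarrow> (u' - u, v' - v) \<in> knight_vectors"
  unfolding knight_move_def by (auto simp: algebra_simps) (metis add.commute diff_add_cancel)

lemma reached_in_iff: "(u, v) \<in> reached_in (p, q) d \<longleftrightarrow> (u - p, v - q) \<in> knight_range d"
proof (induction d arbitrary: u v)
  case 0
  show ?case by (auto simp: reached_in_def knight_range_iff)
next
  case (Suc d)
  have "(u, v) \<in> reached_in (p, q) (Suc d) \<longleftrightarrow>
      (\<exists>u' v'. (u' - p, v' - q) \<in> knight_range d \<and> (u - u', v - v') \<in> knight_vectors)"
    using Suc by (auto simp: reached_in_def relcomp_unfold knight_move_iff)
  also have "\<dots> \<longleftrightarrow> retractable d (u - p) (v - q)"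
  proof
    assume "\<exists>u' v'. (u' - p, v' - q) \<in> knight_range d \<and> (u - u', v - v') \<in> knight_vectors"
    then obtain u' v'
      where "(u' - p, v' - q) \<in> knight_range d" "(u - u', v - v') \<in> knight_vectors" by blast
    then show "retractable d (u - p) (v - q)"
      by (intro retractableI[of "u - u'" "v - v'"]) auto
  next
    assume "retractable d (u - p) (v - q)"
    then obtain a b where "(a, b) \<in> knight_vectors" "(u - p - a, v - q - b) \<in> knight_range d"
      unfolding retractable_def by blast
    then show "\<exists>u' v'. (u' - p, v' - q) \<in> knight_range d \<and> (u - u', v - v') \<in> knight_vectors"
      by (intro exI[of _ "u - a"] exI[of _ "v - b"]) (simp add: algebra_simps)
  qed
  finally show ?case by (simp add: knight_range_Suc)
qed

section \<open>Counting the octagon\<close>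

lemma sum_Suc_upto_double: "2 * (\<Sum>k = d..<2 * d. Suc k) = 3 * d * d + d"
proof -
  have "2 * (\<Sum>k = d..<d + n. Suc k) = n * (2 * d + n + 1)" for n
    by (induction n) (auto simp: algebra_simps)
  from this[of d] show ?thesis by (simp add: algebra_simps flip: mult_2)
qed

lemma nonneg_evenE:
  fixes n :: int
  assumes "even n" "0 \<le> n"
  obtains i where "n = 2 * int i"
  using assms that[of "nat (n div 2)"] by auto

text \<open>
  The octagon is cut along the lines \<open>\<bar>x\<bar> = d\<close>. In the middle strip the points form two
  rectangular grids, one for each parity of \<open>x\<close>; in the right cap the column
  \<open>x = 3d - k\<close> consists of the \<open>k + 1\<close> values \<open>y = -k, -k + 2, \<dots>, k\<close>; the left cap is its
  mirror image.
\<close>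

lemma card_octagon: "finite (octagon d) \<and> card (octagon d) = 7 * d * d + 4 * d + 1"
proof -
  define A where "A = (\<lambda>(i, j). (2 * int i - int d, 2 * int j - 2 * int d)) ` ({..d} \<times> {..2 * d})"
  define B where
    "B = (\<lambda>(i, j). (2 * int i + 1 - int d, 2 * int j + 1 - 2 * int d)) ` ({..<d} \<times> {..<2 * d})"
  define K where "K = (SIGMA k : {d..<2 * d}. {..k})"
  define C where "C = (\<lambda>(k, j). (3 * int d - int k, 2 * int j - int k)) ` K"
  define C' where "C' = (\<lambda>(k, j). (int k - 3 * int d, 2 * int j - int k)) ` K"
  have fin: "finite A" "finite B" "finite C" "finite C'"
    unfolding A_def B_def C_def C'_def K_def by auto
  have "inj_on (\<lambda>(i, j). (2 * int i - int d, 2 * int j - 2 * int d)) ({..d} \<times> {..2 * d})"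
    by (auto simp: inj_on_def)
  then have cA: "card A = (d + 1) * (2 * d + 1)" unfolding A_def by (simp add: card_image)
  have "inj_on (\<lambda>(i, j). (2 * int i + 1 - int d, 2 * int j + 1 - 2 * int d)) ({..<d} \<times> {..<2 * d})"
    by (auto simp: inj_on_def)
  then have cB: "card B = d * (2 * d)" unfolding B_def by (simp add: card_image)
  have cK: "2 * card K = 3 * d * d + d"
    unfolding K_def using sum_Suc_upto_double by simp
  have cC: "card C = card K" unfolding C_def by (rule card_image) (auto simp: inj_on_def)
  have cC': "card C' = card K" unfolding C'_def by (rule card_image) (auto simp: inj_on_def)
  have A: "(x, y) \<in> A \<longleftrightarrow> \<bar>x\<bar> \<le> int d \<and> \<bar>y\<bar> \<le> 2 * int d \<and> even (x + int d) \<and> even y"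
    (is "_ \<longleftrightarrow> ?P") for x y
  proof
    assume P: ?P
    obtain i where i: "x + int d = 2 * int i" by (rule nonneg_evenE[of "x + int d"]) (use P in auto)
    obtain j where j: "y + 2 * int d = 2 * int j"
      by (rule nonneg_evenE[of "y + 2 * int d"]) (use P in auto)
    have "i \<le> d" "j \<le> 2 * d" using P i j by linarith+
    with i j show "(x, y) \<in> A" unfolding A_def
      by (intro image_eqI[of _ _ "(i, j)"]) auto
  qed (auto simp: A_def)
  have B: "(x, y) \<in> B \<longleftrightarrow> \<bar>x\<bar> \<le> int d \<and> \<bar>y\<bar> \<le> 2 * int d \<and> odd (x + int d) \<and> odd y"
    (is "_ \<longleftrightarrow> ?P") for x y
  proof
    assume P: ?P
    then have "x \<noteq> int d" "x \<noteq> - int d" "y \<noteq> 2 * int d" "y \<noteq> - 2 * int d" by auto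
    with P have bounds: "\<bar>x\<bar> < int d" "\<bar>y\<bar> < 2 * int d" by linarith+
    obtain i where i: "x + int d - 1 = 2 * int i"
      by (rule nonneg_evenE[of "x + int d - 1"]) (use P bounds in auto)
    obtain j where j: "y + 2 * int d - 1 = 2 * int j"
      by (rule nonneg_evenE[of "y + 2 * int d - 1"]) (use P bounds in auto)
    have "i < d" "j < 2 * d" using bounds i j by linarith+
    with i j show "(x, y) \<in> B" unfolding B_def
      by (intro image_eqI[of _ _ "(i, j)"]) auto
  qed (auto simp: B_def)
  have C: "(x, y) \<in> C \<longleftrightarrow> int d < x \<and> x \<le> 2 * int d \<and> x + \<bar>y\<bar> \<le> 3 * int d
      \<and> even (x + y + int d)" (is "_ \<longleftrightarrow> ?P") for x y
  proof
    assume P: ?P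
    obtain k where k: "x = 3 * int d - int k" "d \<le> k" "k < 2 * d"
      using P by (intro that[of "nat (3 * int d - x)"]) auto
    have "even (y + int k)" using P k(1) by auto
    then obtain j where j: "y + int k = 2 * int j"
      by (rule nonneg_evenE) (use P k in auto)
    have "j \<le> k" using P k(1) j by linarith
    with j k show "(x, y) \<in> C" unfolding C_def K_def
      by (intro image_eqI[of _ _ "(k, j)"]) auto
  qed (auto simp: C_def K_def)
  have C': "(x, y) \<in> C' \<longleftrightarrow> x < - int d \<and> - x \<le> 2 * int d \<and> - x + \<bar>y\<bar> \<le> 3 * int d
      \<and> even (x + y + int d)" (is "_ \<longleftrightarrow> ?P") for x y
  proof
    assume P: ?P
    obtain k where k: "x = int k - 3 * int d" "d \<le> k" "k < 2 * d"
      using P by (intro that[of "nat (3 * int d + x)"]) auto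
    have "even (y + int k)" using P k(1) by auto
    then obtain j where j: "y + int k = 2 * int j"
      by (rule nonneg_evenE) (use P k in auto)
    have "j \<le> k" using P k(1) j by linarith
    with j k show "(x, y) \<in> C'" unfolding C'_def K_def
      by (intro image_eqI[of _ _ "(k, j)"]) auto
  qed (auto simp: C'_def K_def)
  have "octagon d = A \<union> B \<union> (C \<union> C')"
  proof (rule set_eqI, clarify)
    fix x y
    have parity: "even (x + y + int d) \<longleftrightarrow> (even (x + int d) \<longleftrightarrow> even y)" by auto
    show "(x, y) \<in> octagon d \<longleftrightarrow> (x, y) \<in> A \<union> B \<union> (C \<union> C')"
      unfolding Un_iff A B C C' octagon_def mem_Collect_eq prod.case parity
      by (smt (verit))
  qed
  moreover have "A \<inter> B = {}" "C \<inter> C' = {}" "(A \<union> B) \<inter> (C \<union> C') = {}"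
    by (auto simp: A B C C')
  ultimately have "card (octagon d) = (card A + card B) + (card C + card C')"
    using fin by (simp add: card_Un_disjoint)
  also have "\<dots> = 7 * d * d + 4 * d + 1"
    using cA cB cK cC cC' by (simp add: algebra_simps)
  finally show ?thesis using fin \<open>octagon d = A \<union> B \<union> (C \<union> C')\<close> by simp
qed

lemma finite_knight_range: "finite (knight_range d)"
  unfolding knight_range_def using card_octagon by blast

lemma card_knight_range:
  "card (knight_range d) = 7 * d * d + 4 * d + 1 - (if d = 1 \<or> d = 2 then 4 else 0)"
proof -
  have "unreached d \<subseteq> octagon d" "finite (unreached d)"
    by (auto simp: unreached_def octagon_def)
  moreover have "card (unreached d) = (if d = 1 \<or> d = 2 then 4 else 0)"
    by (simp add: unreached_def card_cartesian_product)
  ultimately show ?thesis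
    unfolding knight_range_def using card_octagon by (simp add: card_Diff_subset)
qed

section \<open>The squares reached first at move \<open>d\<close>\<close>

text \<open>
  The octagons grow with \<open>d\<close>, and removing the exceptional squares does no harm: those missing
  at \<open>d = 1\<close> and at \<open>d = 2\<close> are not reached at any earlier time of the same parity.
\<close>

lemma knight_range_mono:
  assumes "i \<le> d" "even (d - i)"
  shows "knight_range i \<subseteq> knight_range d"
  using assms by (auto simp: knight_range_iff)

lemma knight_range_parity:
  assumes "t \<in> knight_range i" "t \<in> knight_range d"
  shows "even (int d - int i)"
  using assms by (cases t) (auto simp: knight_range_iff)

lemma knight_range_first:
  assumes "d \<ge> 2"
  shows "knight_range d - (\<Union>i<d. knight_range i) = knight_range d - knight_range (d - 2)"
proof -
  have "t \<in> knight_range (d - 2)"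
    if "t \<in> knight_range d" "i < d" "t \<in> knight_range i" for t i
  proof -
    have "even (int d - int i)" using that knight_range_parity by blast
    then have "i \<le> d - 2" "even (d - 2 - i)" using that(2) assms by presburger+
    then show ?thesis using knight_range_mono that(3) by blast
  qed
  moreover have "d - 2 < d" using assms by simp
  ultimately show ?thesis by blast
qed

lemma g_eq_card: "g s d = card (knight_range d - (\<Union>i<d. knight_range i))"
proof (cases s)
  case (Pair p q)
  let ?N = "knight_range d - (\<Union>i<d. knight_range i)"
  have "new_squares s d = (\<lambda>(x, y). (x + p, y + q)) ` ?N"
  proof (rule set_eqI, clarify)
    fix u v
    have "(u, v) \<in> new_squares s d \<longleftrightarrow> (u - p, v - q) \<in> ?N"
      unfolding new_squares_def Pair by (auto simp: reached_in_iff)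
    also have "\<dots> \<longleftrightarrow> (u, v) \<in> (\<lambda>(x, y). (x + p, y + q)) ` ?N"
    proof
      assume "(u - p, v - q) \<in> ?N"
      then show "(u, v) \<in> (\<lambda>(x, y). (x + p, y + q)) ` ?N"
        by (intro image_eqI[of _ _ "(u - p, v - q)"]) simp_all
    next
      assume "(u, v) \<in> (\<lambda>(x, y). (x + p, y + q)) ` ?N"
      then obtain x y where "u = x + p" "v = y + q" "(x, y) \<in> ?N" by auto
      then show "(u - p, v - q) \<in> ?N" by simp
    qed
    finally show "(u, v) \<in> new_squares s d \<longleftrightarrow> (u, v) \<in> (\<lambda>(x, y). (x + p, y + q)) ` ?N" .
  qed
  moreover have "inj_on (\<lambda>(x, y). (x + p, y + q)) ?N" by (auto simp: inj_on_def)
  ultimately show ?thesis unfolding g_def by (simp add: card_image)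
qed

theorem mainTheorem5:
  fixes s :: "int \<times> int" and d :: nat
  shows "g s d =
    (if d = 0 then 1
     else if d = 1 then 8
     else if d = 2 then 32
     else if d = 3 then 68
     else if d = 4 then 96
     else 28 * d - 20)"
proof -
  consider "d = 0" | "d = 1" | "d \<ge> 2" by linarith
  then show ?thesis
  proof cases
    case 1
    then show ?thesis by (simp add: g_eq_card card_knight_range)
  next
    case 2
    have "knight_range 1 - (\<Union>i<1. knight_range i) = knight_range 1"
      using knight_range_parity by fastforce
    then show ?thesis using 2 by (simp add: g_eq_card card_knight_range)
  next
    case 3
    then obtain e where e: "d = e + 2" by (metis add.commute le_Suc_ex)
    have "g s d = card (knight_range d) - card (knight_range e)"
      using knight_range_first[of d] knight_range_mono[of e d] finite_knight_range[of e] e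
      by (simp add: g_eq_card card_Diff_subset)
    also have "\<dots> = (if e = 0 then 32 else if e = 1 then 68 else if e = 2 then 96 else 28 * e + 36)"
    proof -
      consider "e = 0" | "e = 1" | "e = 2" | "e \<ge> 3" by linarith
      then show ?thesis by cases (simp_all add: card_knight_range e algebra_simps)
    qed
    finally show ?thesis by (auto simp: e)
  qed
qed

end
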